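(* Let $A$ be a C*-algebra acting on a Hilbert space $H$, let $w(A)$ be the weak closure of $A$ in $B(H)$, and let $e$ be an Abelian projection in $w(A)$ such that $A\cap e\,w(A)\,e\neq\{0\}$. Then $\mathrm{Ann}(\mathrm{Ann}(A\cap e\,w(A)\,e))$ is an Abelian (commutative) C*-algebra.
   Context: For $S\subseteq A$, $\mathrm{Ann}(S)=\{a\in A: as+sa=0\ \forall s\in S\}$. A projection $e$ in a von Neumann algebra $M$ is Abelian if $eMe$ is commutative. *)

theory Defs
  imports Complex_Main
begin

class complex_hilbert = ab_group_add +
  fixes cscale :: "complex \<Rightarrow> 'a \<Rightarrow> 'a" (infixr "*\<^sub>C" 75)
    and cinner :: "'a \<Rightarrow> 'a \<Rightarrow> complex"
  assumes cscale_add_right: "c *\<^sub>C (x + y) = c *\<^sub>C x + c *\<^sub>C y"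
    and cscale_add_left: "(c + d) *\<^sub>C x = c *\<^sub>C x + d *\<^sub>C x"
    and cscale_cscale: "c *\<^sub>C (d *\<^sub>C x) = (c * d) *\<^sub>C x"
    and cscale_one: "1 *\<^sub>C x = x"
    and cinner_cnj: "cinner x y = cnj (cinner y x)"
    and cinner_add_left: "cinner (x + y) z = cinner x z + cinner y z"
    and cinner_cscale_left: "cinner (c *\<^sub>C x) y = cnj c * cinner x y"
    and cinner_self_nonneg: "Im (cinner x x) = 0 \<and> Re (cinner x x) \<ge> 0"
    and cinner_self_zero: "cinner x x = 0 \<Longrightarrow> x = 0"
    and complete: "(\<forall>e>0. \<exists>N::nat. \<forall>m\<ge>N. \<forall>n\<ge>N.
                       sqrt (Re (cinner ((X::nat \<Rightarrow> 'a) m - X n) (X m - X n))) < e)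
                   \<Longrightarrow> \<exists>L. \<forall>e>0. \<exists>N::nat. \<forall>n\<ge>N.
                       sqrt (Re (cinner (X n - L) (X n - L))) < e"

definition hnorm :: "'h::complex_hilbert \<Rightarrow> real" where
  "hnorm x = sqrt (Re (cinner x x))"

definition bounded_op :: "('h::complex_hilbert \<Rightarrow> 'h) \<Rightarrow> bool" where
  "bounded_op T \<longleftrightarrow> (\<forall>x y. T (x + y) = T x + T y) \<and> (\<forall>c x. T (c *\<^sub>C x) = c *\<^sub>C T x)
     \<and> (\<exists>K. \<forall>x. hnorm (T x) \<le> K * hnorm x)"

definition opnorm :: "('h::complex_hilbert \<Rightarrow> 'h) \<Rightarrow> real" where
  "opnorm T = Sup {hnorm (T x) | x. hnorm x \<le> 1}"

definition adjoint :: "('h::complex_hilbert \<Rightarrow> 'h) \<Rightarrow> ('h \<Rightarrow> 'h)" where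
  "adjoint T = (SOME S. \<forall>x y. cinner (T x) y = cinner x (S y))"

definition cstar_algebra :: "('h::complex_hilbert \<Rightarrow> 'h) set \<Rightarrow> bool" where
  "cstar_algebra A \<longleftrightarrow>
     A \<subseteq> {T. bounded_op T} \<and> (\<lambda>x. 0) \<in> A
     \<and> (\<forall>S\<in>A. \<forall>T\<in>A. (\<lambda>x. S x + T x) \<in> A)
     \<and> (\<forall>c. \<forall>T\<in>A. (\<lambda>x. c *\<^sub>C T x) \<in> A)
     \<and> (\<forall>S\<in>A. \<forall>T\<in>A. S \<circ> T \<in> A)
     \<and> (\<forall>T\<in>A. adjoint T \<in> A)
     \<and> (\<forall>T. bounded_op T \<and> (\<forall>e>0. \<exists>a\<in>A. opnorm (\<lambda>x. T x - a x) < e) \<longrightarrow> T \<in> A)"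

definition weak_closure :: "('h::complex_hilbert \<Rightarrow> 'h) set \<Rightarrow> ('h \<Rightarrow> 'h) set" where
  "weak_closure A = {T. bounded_op T \<and>
     (\<forall>F e. finite F \<and> e > 0 \<longrightarrow>
        (\<exists>a\<in>A. \<forall>(x, y)\<in>F. cmod (cinner y (T x - a x)) < e))}"

definition commutative_set :: "('h \<Rightarrow> 'h) set \<Rightarrow> bool" where
  "commutative_set S \<longleftrightarrow> (\<forall>a\<in>S. \<forall>b\<in>S. a \<circ> b = b \<circ> a)"

definition corner :: "('h \<Rightarrow> 'h) \<Rightarrow> ('h \<Rightarrow> 'h) set \<Rightarrow> ('h \<Rightarrow> 'h) set" where
  "corner e M = {e \<circ> m \<circ> e | m. m \<in> M}"

definition abelian_projection :: "('h::complex_hilbert \<Rightarrow> 'h) set \<Rightarrow> ('h \<Rightarrow> 'h) \<Rightarrow> bool" where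
  "abelian_projection M e \<longleftrightarrow> e \<in> M \<and> e \<circ> e = e \<and> adjoint e = e
     \<and> commutative_set (corner e M)"

definition Ann :: "('h::complex_hilbert \<Rightarrow> 'h) set \<Rightarrow> ('h \<Rightarrow> 'h) set \<Rightarrow> ('h \<Rightarrow> 'h) set" where
  "Ann A S = {a \<in> A. \<forall>s\<in>S. (\<lambda>x. a (s x) + s (a x)) = (\<lambda>x. 0)}"

end

theory Submission
  imports Defs
begin

text \<open>
  Write \<open>B\<close> for \<open>A \<inter> e w(A) e\<close>. It is a commutative self-adjoint subalgebra of \<open>A\<close> with
  \<open>B A B \<subseteq> B\<close>. The Jordan annihilator of a self-adjoint set closed under products is the two-sided
  annihilator: for \<open>h = s\<^sup>* s\<close> the relation \<open>a h = - h a\<close> gives \<open>a h\<^sup>2 = - h a h = h\<^sup>2 a\<close>, while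
  also \<open>a h\<^sup>2 = - h\<^sup>2 a\<close>, so that \<open>h\<^sup>2 a = 0\<close>; hence \<open>h a = 0\<close> and \<open>s a = 0\<close>.
  Put \<open>N = Ann B\<close> and \<open>D = Ann N\<close>. If \<open>t \<in> D\<close> and \<open>B t = 0\<close>, then \<open>t t\<^sup>* \<in> N \<inter> D\<close>, so
  \<open>t = 0\<close>. For \<open>u \<in> D\<close> and \<open>c, d \<in> B\<close> the element \<open>u c d - d u c\<close> is killed by \<open>B\<close> from
  the left, because \<open>b u c\<close> lies in the commutative set \<open>B\<close>. Thus \<open>u c d = d u c\<close>, from which
  \<open>B\<close> is central in \<open>D\<close> and \<open>D B B \<subseteq> B\<close>. Consequently \<open>[u, v] c d = 0\<close> for \<open>u, v \<in> D\<close>,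
  and cancelling \<open>d\<close> and \<open>c\<close> gives \<open>[u, v] = 0\<close>.
\<close>

section \<open>Riesz representation and adjoints\<close>

lemma cscale_zero_right [simp]: "c *\<^sub>C (0::'h::complex_hilbert) = 0"
  using cscale_add_right[of c "0::'h" 0] by simp

lemma cscale_zero_left [simp]: "0 *\<^sub>C (x::'h::complex_hilbert) = 0"
  using cscale_add_left[of 0 0 x] by simp

lemma cscale_uminus_one: "(-1) *\<^sub>C (x::'h::complex_hilbert) = - x"
proof -
  have "(-1) *\<^sub>C x + x = 0"
    using cscale_add_left[of "-1" 1 x] by (simp add: cscale_one)
  then show ?thesis by (simp add: eq_neg_iff_add_eq_0)
qed

lemma cinner_add_right: "cinner x (y + z) = cinner x y + cinner x (z::'h::complex_hilbert)"
  by (metis cinner_add_left cinner_cnj complex_cnj_add)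

lemma cinner_cscale_right: "cinner x (c *\<^sub>C y) = c * cinner x (y::'h::complex_hilbert)"
  by (metis cinner_cnj cinner_cscale_left complex_cnj_cnj complex_cnj_mult)

lemma cinner_zero_left [simp]: "cinner 0 (y::'h::complex_hilbert) = 0"
  using cinner_add_left[of 0 0 y] by simp

lemma cinner_zero_right [simp]: "cinner (y::'h::complex_hilbert) 0 = 0"
  using cinner_add_right[of y 0 0] by simp

lemma cinner_minus_left [simp]: "cinner (- x) (y::'h::complex_hilbert) = - cinner x y"
  using cinner_add_left[of x "-x" y] by (simp add: eq_neg_iff_add_eq_0 add.commute)

lemma cinner_minus_right [simp]: "cinner x (- y::'h::complex_hilbert) = - cinner x y"
  using cinner_add_right[of x y "-y"] by (simp add: eq_neg_iff_add_eq_0 add.commute)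

lemma cinner_diff_left: "cinner (x - y) (z::'h::complex_hilbert) = cinner x z - cinner y z"
  using cinner_add_left[of x "-y" z] by simp

lemma cinner_diff_right: "cinner z (x - y::'h::complex_hilbert) = cinner z x - cinner z y"
  using cinner_add_right[of z x "-y"] by simp

lemma cinner_left_cancel:
  assumes "\<And>x. cinner x y = cinner x (z::'h::complex_hilbert)"
  shows "y = z"
  using cinner_self_zero[of "y - z"] assms[of "y - z"] by (simp add: cinner_diff_right)

lemma Re_cinner_commute: "Re (cinner x y) = Re (cinner y (x::'h::complex_hilbert))"
  by (subst cinner_cnj) simp

section \<open>The norm and the Cauchy-Schwarz inequality\<close>

lemma hnorm_nonneg [simp]: "0 \<le> hnorm (x::'h::complex_hilbert)"
  by (simp add: hnorm_def cinner_self_nonneg)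

lemma hnorm_square: "(hnorm (x::'h::complex_hilbert))\<^sup>2 = Re (cinner x x)"
  by (simp add: hnorm_def cinner_self_nonneg)

lemma hnorm_eq_zero: "hnorm x = 0 \<longleftrightarrow> x = (0::'h::complex_hilbert)"
proof
  assume "hnorm x = 0"
  then have "Re (cinner x x) = 0" using hnorm_square[of x] by simp
  then have "cinner x x = 0" by (simp add: complex_eq_iff cinner_self_nonneg)
  then show "x = 0" by (rule cinner_self_zero)
qed (simp add: hnorm_def)

lemma hnorm_cscale_real: "hnorm (complex_of_real t *\<^sub>C (x::'h::complex_hilbert)) = \<bar>t\<bar> * hnorm x"
proof -
  have "Re (cinner (complex_of_real t *\<^sub>C x) (complex_of_real t *\<^sub>C x)) = t\<^sup>2 * Re (cinner x x)"
    by (simp add: cinner_cscale_left cinner_cscale_right power2_eq_square)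
  then show ?thesis by (simp add: hnorm_def real_sqrt_mult)
qed

text \<open>Along a real line the squared norm is a real quadratic in \<open>t\<close>.
  Cauchy-Schwarz, the triangle inequality and the minimisation in the Riesz argument all start from
  this expansion.\<close>

lemma hnorm_square_add_cscale:
  "(hnorm (x + complex_of_real t *\<^sub>C y))\<^sup>2
    = (hnorm x)\<^sup>2 + 2 * t * Re (cinner x y) + t\<^sup>2 * (hnorm (y::'h::complex_hilbert))\<^sup>2"
  using Re_cinner_commute[of y x]
  by (simp only: hnorm_square) (simp add: cinner_add_left cinner_add_right cinner_cscale_left
      cinner_cscale_right power2_eq_square algebra_simps)

lemma Re_cinner_le: "Re (cinner x y) \<le> hnorm x * hnorm (y::'h::complex_hilbert)"
proof (cases "y = 0")
  case False
  then have y: "hnorm y > 0" using hnorm_eq_zero[of y] hnorm_nonneg[of y] by linarith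
  define r where "r = Re (cinner x y)"
  \<comment> \<open>The chosen parameter is the minimiser of the quadratic in
    \<open>t\<close>.\<close>
  have "0 \<le> (hnorm (x + complex_of_real (- r / (hnorm y)\<^sup>2) *\<^sub>C y))\<^sup>2" by simp
  also have "\<dots> = (hnorm x)\<^sup>2 - r\<^sup>2 / (hnorm y)\<^sup>2"
    using y by (simp only: hnorm_square_add_cscale r_def[symmetric])
      (simp add: field_simps power2_eq_square)
  finally have "r\<^sup>2 \<le> (hnorm x * hnorm y)\<^sup>2"
    using y by (simp add: field_simps)
  then have "r \<le> hnorm x * hnorm y"
    by (rule power2_le_imp_le) simp
  then show ?thesis by (simp add: r_def)
qed (simp add: hnorm_def)

lemma abs_Re_cinner_le: "\<bar>Re (cinner x y)\<bar> \<le> hnorm x * hnorm (y::'h::complex_hilbert)"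
  using Re_cinner_le[of x y] Re_cinner_le[of "-x" y] by (simp add: hnorm_def abs_le_iff)

lemma hnorm_triangle: "hnorm (x + y) \<le> hnorm x + hnorm (y::'h::complex_hilbert)"
proof (rule power2_le_imp_le)
  show "(hnorm (x + y))\<^sup>2 \<le> (hnorm x + hnorm y)\<^sup>2"
    using hnorm_square_add_cscale[of x 1 y] Re_cinner_le[of x y]
    by (simp add: cscale_one power2_sum)
qed simp

lemma hnorm_minus [simp]: "hnorm (- x) = hnorm (x::'h::complex_hilbert)"
  by (simp add: hnorm_def)

section \<open>Completeness and the Riesz representation\<close>

lemma hilbert_complete:
  fixes X :: "nat \<Rightarrow> 'h::complex_hilbert"
  assumes "\<And>r. r > 0 \<Longrightarrow> \<exists>N. \<forall>m\<ge>N. \<forall>n\<ge>N. hnorm (X m - X n) < r"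
  obtains L where "(\<lambda>n. hnorm (X n - L)) \<longlonglongrightarrow> 0"
proof -
  have "\<exists>L. \<forall>e>0. \<exists>N::nat. \<forall>n\<ge>N. hnorm (X n - L) < e"
    using complete[of X] assms unfolding hnorm_def by blast
  then show thesis using that by (auto simp: LIMSEQ_iff)
qed

text \<open>The representing vector is the limit of a minimising sequence for \<open>\<parallel>x\<parallel>\<^sup>2 - 2 Re f(x)\<close>.\<close>

lemma riesz_representation:
  fixes f :: "'h::complex_hilbert \<Rightarrow> complex"
  assumes add: "\<And>x y. f (x + y) = f x + f y"
    and scale: "\<And>c x. f (c *\<^sub>C x) = c * f x"
    and bound: "\<And>x. \<bar>Re (f x)\<bar> \<le> K * hnorm x"
  obtains z where "\<And>x. f x = cinner z x"
proof -
  define J where "J x = (hnorm x)\<^sup>2 - 2 * Re (f x)" for x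
  have J_line: "J (x + complex_of_real t *\<^sub>C k)
      = J x + 2 * t * (Re (cinner x k) - Re (f k)) + t\<^sup>2 * (hnorm k)\<^sup>2" for x t k
    by (simp add: J_def hnorm_square_add_cscale add scale algebra_simps)
  have "- K\<^sup>2 \<le> J x" for x
  proof -
    have "0 \<le> (hnorm x - K)\<^sup>2" by simp
    then show ?thesis
      using bound[of x] by (simp add: J_def power2_eq_square algebra_simps abs_le_iff)
  qed
  then have bdd: "bdd_below (range J)" by (intro bdd_belowI[of _ "- K\<^sup>2"]) auto
  define d where "d = Inf (range J)"
  have d: "d \<le> J x" for x unfolding d_def by (rule cInf_lower) (use bdd in auto)
  have "\<exists>x. J x < d + inverse (real (Suc n))" for n
  proof -
    have "Inf (range J) < d + inverse (real (Suc n))" by (simp add: d_def)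
    then show ?thesis using cInf_lessD[of "range J"] by auto
  qed
  then obtain X where X: "\<And>n. J (X n) < d + inverse (real (Suc n))" by metis
  have cauchy: "(hnorm (X m - X n))\<^sup>2 < 2 * inverse (real (Suc m)) + 2 * inverse (real (Suc n))"
    for m n
  proof -
    define k where "k = X m - X n"
    have m: "X m = X n + complex_of_real 1 *\<^sub>C k" by (simp add: k_def cscale_one)
    \<comment> \<open>The midpoint of \<open>X m\<close> and \<open>X n\<close> cannot have a value
      below \<open>d\<close>; the parallelogram identity turns this into a bound on
      \<open>hnorm k\<close>.\<close>
    have "d \<le> J (X n + complex_of_real (1/2) *\<^sub>C k)" by (rule d)
    then have "4 * d + (hnorm k)\<^sup>2 \<le> 2 * J (X m) + 2 * J (X n)"
      unfolding m J_line by (simp add: power2_eq_square)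
    then show ?thesis using X[of m] X[of n] by (simp add: k_def)
  qed
  obtain L where L: "(\<lambda>n. hnorm (X n - L)) \<longlonglongrightarrow> 0"
  proof (rule hilbert_complete)
    fix r :: real assume r: "r > 0"
    obtain N where N: "inverse (real (Suc N)) < r\<^sup>2 / 4"
      using reals_Archimedean[of "r\<^sup>2 / 4"] r by auto
    have "hnorm (X m - X n) < r" if "m \<ge> N" "n \<ge> N" for m n
    proof (rule power2_less_imp_less)
      have "inverse (real (Suc m)) \<le> inverse (real (Suc N))"
        "inverse (real (Suc n)) \<le> inverse (real (Suc N))"
        using that by (auto intro!: le_imp_inverse_le)
      then show "(hnorm (X m - X n))\<^sup>2 < r\<^sup>2" using cauchy[of m n] N by linarith
    qed (use r in simp)
    then show "\<exists>N. \<forall>m\<ge>N. \<forall>n\<ge>N. hnorm (X m - X n) < r" by blast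
  qed (use that in blast)
  have J_lim: "(\<lambda>n. J (X n)) \<longlonglongrightarrow> d"
  proof (rule tendsto_sandwich[of "\<lambda>_. d"])
    show "(\<lambda>n. d + inverse (real (Suc n))) \<longlonglongrightarrow> d"
      using LIMSEQ_inverse_real_of_nat_add[of d] by simp
    show "\<forall>\<^sub>F n in sequentially. J (X n) \<le> d + inverse (real (Suc n))"
      using X by (intro always_eventually allI less_imp_le)
  qed (use d in auto)
  have Re_lim: "(\<lambda>n. Re (cinner (X n) k)) \<longlonglongrightarrow> Re (cinner L k)" for k
  proof -
    have "(\<lambda>n. Re (cinner (X n - L) k)) \<longlonglongrightarrow> 0"
      by (rule tendsto_0_le[OF L, of _ "hnorm k"]) (simp add: abs_Re_cinner_le)
    then show ?thesis by (simp add: cinner_diff_left LIM_zero_iff)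
  qed
  have Re_eq: "Re (cinner L k) = Re (f k)" for k
  proof -
    define s where "s = Re (cinner L k) - Re (f k)"
    \<comment> \<open>On the line through \<open>X n\<close> in direction \<open>k\<close> the
      values stay above \<open>d\<close>. As \<open>n\<close> grows the quadratic converges
      coefficientwise, so the limit quadratic stays above \<open>d\<close> too.\<close>
    have quad: "0 \<le> 2 * t * s + t\<^sup>2 * (hnorm k)\<^sup>2" for t
    proof -
      have "(\<lambda>n. J (X n + complex_of_real t *\<^sub>C k)) \<longlonglongrightarrow> d + 2 * t * s + t\<^sup>2 * (hnorm k)\<^sup>2"
        unfolding J_line s_def by (intro tendsto_intros J_lim Re_lim)
      then have "d \<le> d + 2 * t * s + t\<^sup>2 * (hnorm k)\<^sup>2"
        by (rule LIMSEQ_le_const) (use d in auto)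
      then show ?thesis by simp
    qed
    have p: "0 < 1 + (hnorm k)\<^sup>2" by (simp add: add_pos_nonneg)
    \<comment> \<open>The \<open>1 +\<close> in the parameter keeps the denominator positive even
      for \<open>k = 0\<close>; the factor of the square of \<open>s\<close> is still negative,
      which forces \<open>s = 0\<close>.\<close>
    have "0 \<le> s\<^sup>2 * (- 2 / (1 + (hnorm k)\<^sup>2) + (hnorm k)\<^sup>2 / (1 + (hnorm k)\<^sup>2)\<^sup>2)"
      using quad[of "- s / (1 + (hnorm k)\<^sup>2)"] by (simp add: power2_eq_square algebra_simps)
    moreover have "- 2 / (1 + (hnorm k)\<^sup>2) + (hnorm k)\<^sup>2 / (1 + (hnorm k)\<^sup>2)\<^sup>2
        = - (2 + (hnorm k)\<^sup>2) / (1 + (hnorm k)\<^sup>2)\<^sup>2"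
      using p by (simp add: divide_simps power2_eq_square)
    moreover have "- (2 + (hnorm k)\<^sup>2) / (1 + (hnorm k)\<^sup>2)\<^sup>2 < 0"
      using p by (intro divide_neg_pos zero_less_power) linarith+
    ultimately have "s\<^sup>2 \<le> 0" by (metis mult_le_0_iff not_less zero_le_mult_iff)
    then show ?thesis by (simp add: s_def)
  qed
  \<comment> \<open>The imaginary part at \<open>x\<close> is minus the real part at
    \<open>\<i> *\<^sub>C x\<close>.\<close>
  have "f x = cinner L x" for x
    using Re_eq[of x] Re_eq[of "\<i> *\<^sub>C x"]
    by (simp add: complex_eq_iff cinner_cscale_right scale)
  then show thesis by (rule that)
qed

section \<open>Bounded operators and the operator norm\<close>

lemma bounded_op_add: "bounded_op T \<Longrightarrow> T (x + y) = T x + T y"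
  and bounded_op_cscale: "bounded_op T \<Longrightarrow> T (c *\<^sub>C x) = c *\<^sub>C T x"
  by (auto simp: bounded_op_def)

lemma bounded_op_zero: "bounded_op T \<Longrightarrow> T 0 = 0"
  using bounded_op_add[of T 0 0] by simp

lemma bounded_op_minus: "bounded_op T \<Longrightarrow> T (- x) = - T x"
  using bounded_op_cscale[of T "-1" x] by (simp add: cscale_uminus_one)

lemma bounded_op_diff: "bounded_op T \<Longrightarrow> T (x - y) = T x - T y"
  using bounded_op_add[of T x "-y"] by (simp add: bounded_op_minus)

lemma bounded_op_bound:
  assumes "bounded_op T"
  obtains K where "0 \<le> K" "\<And>x. hnorm (T x) \<le> K * hnorm x"
proof -
  obtain K where K: "\<And>x. hnorm (T x) \<le> K * hnorm x"
    using assms by (auto simp: bounded_op_def)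
  have "hnorm (T x) \<le> \<bar>K\<bar> * hnorm x" for x
    by (rule order_trans[OF K[of x]]) (simp add: mult_right_mono)
  then show thesis using that[of "\<bar>K\<bar>"] by simp
qed

lemma bounded_op_sub:
  assumes S: "bounded_op S" and T: "bounded_op T"
  shows "bounded_op (\<lambda>x. S x - T x)"
proof -
  obtain K where K: "\<And>x. hnorm (S x) \<le> K * hnorm x" using bounded_op_bound[OF S] by blast
  obtain M where M: "\<And>x. hnorm (T x) \<le> M * hnorm x" using bounded_op_bound[OF T] by blast
  have "hnorm (S x - T x) \<le> (K + M) * hnorm x" for x
    using hnorm_triangle[of "S x" "- T x"] K[of x] M[of x] by (simp add: algebra_simps)
  moreover have "c *\<^sub>C (S x) - c *\<^sub>C (T x) = c *\<^sub>C (S x - T x)" for c x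
    using cscale_add_right[of c "S x - T x" "T x"] by simp
  ultimately show ?thesis
    using S T by (auto simp: bounded_op_def)
qed

lemma hnorm_le_opnorm:
  assumes T: "bounded_op T"
  shows "hnorm (T x) \<le> opnorm T * hnorm x"
proof (cases "x = 0")
  case True
  then show ?thesis using bounded_op_zero[OF T] by (simp add: hnorm_def)
next
  case False
  then have x: "hnorm x > 0" using hnorm_eq_zero[of x] hnorm_nonneg[of x] by linarith
  obtain K where K: "0 \<le> K" "\<And>x. hnorm (T x) \<le> K * hnorm x"
    using bounded_op_bound[OF T] by blast
  \<comment> \<open>A real \<open>Sup\<close> is an upper bound only for sets that are bounded
    above.\<close>
  have bdd: "bdd_above {hnorm (T x) | x. hnorm x \<le> 1}"
  proof (rule bdd_aboveI)
    fix r assume "r \<in> {hnorm (T x) | x. hnorm x \<le> 1}"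
    then obtain y where "r = hnorm (T y)" "hnorm y \<le> 1" by blast
    then show "r \<le> K" using K(2)[of y] mult_left_mono[of "hnorm y" 1 K] K(1) by simp
  qed
  define y where "y = complex_of_real (1 / hnorm x) *\<^sub>C x"
  have "hnorm y = 1" unfolding y_def hnorm_cscale_real using x by simp
  then have "hnorm (T y) \<le> opnorm T"
    unfolding opnorm_def by (intro cSup_upper bdd) auto
  moreover have "hnorm (T y) = hnorm (T x) / hnorm x"
    unfolding y_def bounded_op_cscale[OF T] hnorm_cscale_real using x by simp
  ultimately show ?thesis using x by (simp add: field_simps)
qed

section \<open>Adjoints\<close>

lemma adjoint_eqI:
  assumes "\<And>x y. cinner (T x) y = cinner x (S y)"
  shows "adjoint T = (S :: 'h::complex_hilbert \<Rightarrow> 'h)"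
proof -
  \<comment> \<open>The given \<open>S\<close> witnesses the choice; nondegeneracy of the inner
    product then makes the chosen operator equal to \<open>S\<close>.\<close>
  have "\<forall>x y. cinner (T x) y = cinner x (adjoint T y)"
    unfolding adjoint_def by (rule someI[of _ S]) (use assms in blast)
  then show ?thesis
    using assms by (intro ext cinner_left_cancel) metis
qed

text \<open>The inner product is linear in its second argument, so Riesz applies to
  \<open>\<lambda>x. cinner y (T x)\<close> for each \<open>y\<close>; conjugation yields the value
  of the adjoint at \<open>y\<close>.\<close>

lemma cinner_adjoint:
  fixes T :: "'h::complex_hilbert \<Rightarrow> 'h"
  assumes T: "bounded_op T"
  shows "cinner (T x) y = cinner x (adjoint T y)"
proof -
  obtain K where K: "0 \<le> K" "\<And>x. hnorm (T x) \<le> K * hnorm x"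
    using bounded_op_bound[OF T] by blast
  have "\<exists>z. \<forall>x. cinner (T x) y = cinner x z" for y
  proof -
    obtain z where "\<And>x. cinner y (T x) = cinner z x"
    proof (rule riesz_representation)
      fix x
      have "\<bar>Re (cinner y (T x))\<bar> \<le> hnorm y * hnorm (T x)" by (rule abs_Re_cinner_le)
      also have "\<dots> \<le> hnorm y * (K * hnorm x)" by (intro mult_left_mono K) simp
      finally show "\<bar>Re (cinner y (T x))\<bar> \<le> (hnorm y * K) * hnorm x" by (simp add: mult.assoc)
    qed (auto simp: bounded_op_add[OF T] bounded_op_cscale[OF T] cinner_add_right
        cinner_cscale_right)
    then show ?thesis by (metis cinner_cnj)
  qed
  then obtain S where S: "\<And>x y. cinner (T x) y = cinner x (S y)" by metis
  from adjoint_eqI[OF S] S show ?thesis by simp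
qed

lemma cinner_adjoint_left: "bounded_op T \<Longrightarrow> cinner (adjoint T x) y = cinner x (T y)"
  by (metis cinner_adjoint cinner_cnj)

lemma adjoint_adjoint: "bounded_op T \<Longrightarrow> adjoint (adjoint T) = T"
  by (rule adjoint_eqI) (rule cinner_adjoint_left)

lemma adjoint_comp:
  "bounded_op S \<Longrightarrow> bounded_op T \<Longrightarrow> adjoint (S \<circ> T) = adjoint T \<circ> adjoint S"
  by (rule adjoint_eqI) (simp add: cinner_adjoint)

text \<open>The squared norm of \<open>T x\<close> is \<open>cinner x (adjoint T (T x))\<close>.
  This vectorwise form of the C*-identity is the main cancellation rule below.\<close>

lemma adjoint_apply_self_eq_zero:
  assumes "bounded_op T" "adjoint T (T x) = 0"
  shows "T x = 0"
  by (rule cinner_self_zero) (simp add: cinner_adjoint assms)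

lemma adjoint_eq_zero:
  assumes "bounded_op T" "\<And>x. adjoint T x = 0"
  shows "T x = 0"
  by (rule adjoint_apply_self_eq_zero) (use assms in auto)

section \<open>Jordan annihilators\<close>

context
  fixes A :: "('h::complex_hilbert \<Rightarrow> 'h) set"
  assumes A: "cstar_algebra A"
begin

lemma cstar_bounded: "T \<in> A \<Longrightarrow> bounded_op T"
  and cstar_zero: "(\<lambda>x. 0) \<in> A"
  and cstar_add: "S \<in> A \<Longrightarrow> T \<in> A \<Longrightarrow> (\<lambda>x. S x + T x) \<in> A"
  and cstar_cscale: "T \<in> A \<Longrightarrow> (\<lambda>x. c *\<^sub>C T x) \<in> A"
  and cstar_comp: "S \<in> A \<Longrightarrow> T \<in> A \<Longrightarrow> S \<circ> T \<in> A"
  and cstar_adjoint: "T \<in> A \<Longrightarrow> adjoint T \<in> A"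
  and cstar_closed: "bounded_op T \<Longrightarrow> (\<And>r. r > 0 \<Longrightarrow> \<exists>a\<in>A. opnorm (\<lambda>x. T x - a x) < r) \<Longrightarrow> T \<in> A"
proof -
  show "T \<in> A \<Longrightarrow> bounded_op T" "(\<lambda>x. 0) \<in> A"
    "S \<in> A \<Longrightarrow> T \<in> A \<Longrightarrow> (\<lambda>x. S x + T x) \<in> A"
    "T \<in> A \<Longrightarrow> (\<lambda>x. c *\<^sub>C T x) \<in> A"
    "S \<in> A \<Longrightarrow> T \<in> A \<Longrightarrow> S \<circ> T \<in> A" "T \<in> A \<Longrightarrow> adjoint T \<in> A"
    using A by (auto simp: cstar_algebra_def)
  have "bounded_op T \<and> (\<forall>r>0. \<exists>a\<in>A. opnorm (\<lambda>x. T x - a x) < r) \<longrightarrow> T \<in> A"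
    using A by (simp add: cstar_algebra_def)
  then show "bounded_op T \<Longrightarrow> (\<And>r. r > 0 \<Longrightarrow> \<exists>a\<in>A. opnorm (\<lambda>x. T x - a x) < r) \<Longrightarrow> T \<in> A"
    by simp
qed

lemma cstar_diff:
  assumes "S \<in> A" "T \<in> A"
  shows "(\<lambda>x. S x - T x) \<in> A"
  using cstar_add[OF assms(1) cstar_cscale[OF assms(2), of "-1"]]
  by (simp add: cscale_uminus_one)

end

text \<open>Reopening the context turns the facts above into rules with a premise on the algebra, so
  that they apply to the annihilators \<open>N\<close> and \<open>D\<close> as well as to
  \<open>A\<close>.\<close>

context
  fixes A :: "('h::complex_hilbert \<Rightarrow> 'h) set"
  assumes A: "cstar_algebra A"
begin

section \<open>Jordan annihilators as two-sided annihilators\<close>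

lemma jordan_annihilates_selfadjoint:
  assumes h: "h \<in> A" "adjoint h = h"
    and ah: "\<And>x. a (h x) + h (a x) = 0"
    and ahh: "\<And>x. a (h (h x)) + h (h (a x)) = 0"
  shows "h (a x) = 0"
proof -
  have eq: "a (h x) = - h (a x)" for x
    using ah[of x] by (simp add: eq_neg_iff_add_eq_0)
  have "a (h (h x)) = h (h (a x))" for x
    unfolding eq using h by (simp only: bounded_op_minus[OF cstar_bounded[OF A]] minus_minus)
  \<comment> \<open>Vectors form only an abelian group with complex scalars, so the factor 2 is
    written as a scalar and cancelled by \<open>1/2\<close>.\<close>
  then have "complex_of_real 2 *\<^sub>C h (h (a x)) = 0" for x
    using ahh[of x] cscale_add_left[of 1 1 "h (h (a x))"] by (simp add: cscale_one)
  then have hha: "h (h (a x)) = 0" for x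
    using cscale_cscale[of "1/2" 2 "h (h (a x))"] by (simp add: cscale_one)
  show ?thesis
    using adjoint_apply_self_eq_zero[OF cstar_bounded[OF A h(1)]] hha h(2) by simp
qed

text \<open>The Jordan condition is not visibly stable under products: two elements anticommuting
  with \<open>s\<close> have a product commuting with \<open>s\<close>. The two-sided form repairs
  this.\<close>

lemma Ann_eq_two_sided:
  assumes S: "S \<subseteq> A" and comp: "\<And>s t. s \<in> S \<Longrightarrow> t \<in> S \<Longrightarrow> s \<circ> t \<in> S"
    and adj: "\<And>s. s \<in> S \<Longrightarrow> adjoint s \<in> S"
  shows "Ann A S = {a \<in> A. \<forall>s\<in>S. \<forall>x. a (s x) = 0 \<and> s (a x) = 0}"
proof (intro equalityI subsetI)
  fix a assume a: "a \<in> Ann A S"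
  then have aA: "a \<in> A" and J: "\<And>s x. s \<in> S \<Longrightarrow> a (s x) + s (a x) = 0"
    by (auto simp: Ann_def fun_eq_iff)
  have sa: "s (a x) = 0" if s: "s \<in> S" for s x
  proof -
    have sA: "s \<in> A" and s': "adjoint s \<in> S" using s S adj by auto
    note b = cstar_bounded[OF A sA] cstar_bounded[OF A cstar_adjoint[OF A sA]]
    define h where "h = adjoint s \<circ> s"
    have h: "h \<in> S" "h \<circ> h \<in> S" unfolding h_def by (intro comp s s')+
    have hA: "h \<in> A" using h(1) S by blast
    have hsa: "adjoint h = h" using b by (simp add: h_def adjoint_comp adjoint_adjoint)
    have "a (h (h x)) + h (h (a x)) = 0" for x using J[OF h(2)] by simp
    then have "h (a x) = 0"
      by (rule jordan_annihilates_selfadjoint[where a = a, OF hA hsa J[OF h(1)]])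
    then show ?thesis
      using adjoint_apply_self_eq_zero[OF b(1)] by (simp add: h_def)
  qed
  \<comment> \<open>Once \<open>s\<close> kills \<open>a\<close> from the left, the Jordan relation
    itself gives the other side.\<close>
  show "a \<in> {a \<in> A. \<forall>s\<in>S. \<forall>x. a (s x) = 0 \<and> s (a x) = 0}"
    using J sa aA by force
qed (auto simp: Ann_def)

text \<open>In the two-sided form the algebraic closure properties are immediate, adjoints exchange
  the two sides, and norm limits are handled by approximation.\<close>

lemma cstar_algebra_Ann:
  assumes S: "S \<subseteq> A" and comp: "\<And>s t. s \<in> S \<Longrightarrow> t \<in> S \<Longrightarrow> s \<circ> t \<in> S"
    and adj: "\<And>s. s \<in> S \<Longrightarrow> adjoint s \<in> S"
  shows "cstar_algebra (Ann A S)"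
proof -
  have Ann_eq: "Ann A S = {a \<in> A. \<forall>s\<in>S. \<forall>x. a (s x) = 0 \<and> s (a x) = 0}"
    by (intro Ann_eq_two_sided assms)
  show ?thesis
    unfolding cstar_algebra_def Ann_eq
  proof (intro conjI ballI allI impI, goal_cases)
    case 1
    show ?case using cstar_bounded[OF A] by blast
  next
    case 2
    then show ?case using S by (auto simp: cstar_zero[OF A] bounded_op_zero[OF cstar_bounded[OF A]] subset_eq)
  next
    case (3 a b)
    then show ?case
      using S by (auto simp: cstar_add[OF A] bounded_op_add[OF cstar_bounded[OF A]] subset_eq)
  next
    case (4 c a)
    then show ?case
      using S by (auto simp: cstar_cscale[OF A] bounded_op_cscale[OF cstar_bounded[OF A]] subset_eq)
  next
    case (5 a b)
    then show ?case
      by (auto simp: cstar_comp[OF A] bounded_op_zero[OF cstar_bounded[OF A]])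
  next
    case (6 a)
    then have a: "a \<in> A" "bounded_op a" and an: "\<And>s x. s \<in> S \<Longrightarrow> a (s x) = 0 \<and> s (a x) = 0"
      using cstar_bounded[OF A] by auto
    have "adjoint a (s x) = 0 \<and> s (adjoint a x) = 0" if s: "s \<in> S" for s x
    proof -
      have b: "bounded_op s" "bounded_op (adjoint s)" and s': "adjoint s \<in> S"
        using s S adj cstar_bounded[OF A] cstar_adjoint[OF A] by blast+
      have "cinner y (adjoint a (s x)) = cinner (adjoint s (a y)) x" for y
        using a b by (simp add: cinner_adjoint adjoint_adjoint)
      then have "adjoint a (s x) = 0"
        using an[OF s'] by (intro cinner_left_cancel) simp
      moreover have "cinner y (s (adjoint a x)) = cinner (a (adjoint s y)) x" for y
        using a b by (simp add: cinner_adjoint adjoint_adjoint)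
      then have "s (adjoint a x) = 0"
        using an[OF s'] by (intro cinner_left_cancel) simp
      ultimately show ?thesis by simp
    qed
    then show ?case using cstar_adjoint[OF A] a by blast
  next
    case (7 T)
    then have T: "bounded_op T" by blast
    have "T \<in> A" using 7 by (intro cstar_closed[OF A]) blast+
    moreover have "T (s x) = 0 \<and> s (T x) = 0" if s: "s \<in> S" for s x
    proof -
      have bs: "bounded_op s" using s S cstar_bounded[OF A] by blast
      obtain K where K: "0 \<le> K" "\<And>x. hnorm (s x) \<le> K * hnorm x"
        using bounded_op_bound[OF bs] by blast
      \<comment> \<open>Since \<open>a\<close> annihilates \<open>s\<close> on both sides,
        \<open>T\<close> may be replaced by \<open>T - a\<close> in both products, and
        \<open>T - a\<close> has norm below \<open>r\<close>.\<close>
      have small: "hnorm (T (s x)) \<le> r * hnorm (s x) \<and> hnorm (s (T x)) \<le> K * (r * hnorm x)"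
        if "r > 0" for r
      proof -
        obtain a where a: "a \<in> A" "\<And>x. a (s x) = 0 \<and> s (a x) = 0"
          and r: "opnorm (\<lambda>x. T x - a x) < r"
          using 7 s \<open>r > 0\<close> by blast
        have n: "hnorm (T y - a y) \<le> r * hnorm y" for y
          using hnorm_le_opnorm[OF bounded_op_sub[OF T cstar_bounded[OF A a(1)]], of y]
            mult_right_mono[OF less_imp_le[OF r], of "hnorm y"] by simp
        have "hnorm (s (T x - a x)) \<le> K * (r * hnorm x)"
          using K(2)[of "T x - a x"] mult_left_mono[OF n[of x] K(1)] by simp
        then show ?thesis using n[of "s x"] a(2) by (simp add: bounded_op_diff[OF bs])
      qed
      have null: "y = 0" if "\<And>r. r > 0 \<Longrightarrow> hnorm y \<le> r * C" for y :: 'h and C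
      proof -
        have "((\<lambda>r. r * C) \<longlongrightarrow> 0 * C) (at_right 0)"
          by (intro tendsto_intros)
        then have "hnorm y \<le> 0 * C"
          by (rule tendsto_lowerbound) (use that in \<open>auto simp: eventually_at_filter\<close>)
        then show ?thesis using hnorm_eq_zero[of y] hnorm_nonneg[of y] by simp
      qed
      have "hnorm (s (T x)) \<le> r * (K * hnorm x)" if "r > 0" for r
        using small[OF that] by (simp add: algebra_simps)
      with small show ?thesis using null by blast
    qed
    ultimately show ?case by blast
  qed
qed

section \<open>The double annihilator of a commutative hereditary subalgebra\<close>

lemma commutative_Ann_Ann:
  assumes B: "B \<subseteq> A" and adj: "\<And>b. b \<in> B \<Longrightarrow> adjoint b \<in> B"
    and comp: "\<And>b c. b \<in> B \<Longrightarrow> c \<in> B \<Longrightarrow> b \<circ> c \<in> B"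
    and hered: "\<And>b a c. b \<in> B \<Longrightarrow> a \<in> A \<Longrightarrow> c \<in> B \<Longrightarrow> b \<circ> a \<circ> c \<in> B"
    and comm: "commutative_set B"
  shows "cstar_algebra (Ann A (Ann A B))" and "commutative_set (Ann A (Ann A B))"
proof -
  define N where "N = Ann A B"
  define D where "D = Ann A N"
  have N: "N = {a \<in> A. \<forall>s\<in>B. \<forall>x. a (s x) = 0 \<and> s (a x) = 0}"
    unfolding N_def by (intro Ann_eq_two_sided B comp adj)
  \<comment> \<open>\<open>N\<close> is again self-adjoint and closed under products, so the
    two-sided description can be applied a second time, to \<open>D\<close>.\<close>
  have cN: "cstar_algebra N"
    unfolding N_def by (intro cstar_algebra_Ann B comp adj)
  have NA: "N \<subseteq> A" using N by auto
  have D: "D = {a \<in> A. \<forall>s\<in>N. \<forall>x. a (s x) = 0 \<and> s (a x) = 0}"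
    unfolding D_def
    by (intro Ann_eq_two_sided NA) (auto intro: cN[THEN cstar_comp] cN[THEN cstar_adjoint])
  have cD: "cstar_algebra D"
    unfolding D_def
    by (intro cstar_algebra_Ann NA) (auto intro: cN[THEN cstar_comp] cN[THEN cstar_adjoint])
  then show "cstar_algebra (Ann A (Ann A B))" by (simp add: D_def N_def)
  note bA = cstar_bounded[OF A]
  note bD = cstar_bounded[OF cD]
  have BD: "B \<subseteq> D" using B by (auto simp: D N)
  have DA: "D \<subseteq> A" using D by auto
  have Bc: "b (c x) = c (b x)" if "b \<in> B" "c \<in> B" for b c x
    using comm that by (metis commutative_set_def comp_apply)
  have left: "t x = 0" if t: "t \<in> D" and Bt: "\<And>b x. b \<in> B \<Longrightarrow> b (t x) = 0" for t x
  proof -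
    have tD: "adjoint t \<in> D" using cstar_adjoint[OF cD t] .
    \<comment> \<open>\<open>B t = 0\<close> is only one half of membership in \<open>N\<close>. The
      self-adjoint \<open>p\<close> inherits it, and taking adjoints supplies the other
      half.\<close>
    define p where "p = t \<circ> adjoint t"
    have p: "p \<in> D" "p \<in> A" unfolding p_def using cstar_comp[OF cD t tD] DA by auto
    have p_sa: "adjoint p = p"
      unfolding p_def using bD[OF t] bD[OF tD] by (simp add: adjoint_comp adjoint_adjoint)
    have Bp: "b (p x) = 0" if "b \<in> B" for b x using Bt[OF that] by (simp add: p_def)
    have "p (b x) = 0" if b: "b \<in> B" for b x
    proof (rule cinner_left_cancel)
      fix y
      have "cinner y (p (b x)) = cinner (adjoint b (p y)) x"
        using bD[OF p(1)] bA[of b] bA[of "adjoint b"] b B adj[OF b]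
        by (simp add: cinner_adjoint p_sa adjoint_adjoint subset_eq)
      then show "cinner y (p (b x)) = cinner y 0" using Bp[OF adj[OF b]] by simp
    qed
    with Bp p have "p \<in> N" by (auto simp: N)
    with p(1) have "p (p x) = 0" for x by (auto simp: D)
    then have "p x = 0" for x
      using adjoint_apply_self_eq_zero[OF bD[OF p(1)]] p_sa by simp
    then have "adjoint t x = 0" for x
      using adjoint_apply_self_eq_zero[OF bD[OF tD]] by (simp add: p_def adjoint_adjoint[OF bD[OF t]])
    then show ?thesis by (rule adjoint_eq_zero[OF bD[OF t]])
  qed
  \<comment> \<open>Apply the left cancellation to \<open>adjoint t\<close>.\<close>
  have right: "t x = 0" if t: "t \<in> D" and tB: "\<And>b x. b \<in> B \<Longrightarrow> t (b x) = 0" for t x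
  proof -
    have "b (adjoint t x) = 0" if b: "b \<in> B" for b x
    proof (rule cinner_left_cancel)
      fix y
      have "cinner y (b (adjoint t x)) = cinner (t (adjoint b y)) x"
        using bD[OF t] bA[of b] bA[of "adjoint b"] b B adj[OF b]
        by (simp add: cinner_adjoint adjoint_adjoint subset_eq)
      then show "cinner y (b (adjoint t x)) = cinner y 0" using tB[OF adj[OF b]] by simp
    qed
    then have "adjoint t x = 0" for x
      using left[OF cstar_adjoint[OF cD t]] by blast
    then show ?thesis by (rule adjoint_eq_zero[OF bD[OF t]])
  qed
  have shift: "u (c (d x)) = d (u (c x))" if u: "u \<in> D" and c: "c \<in> B" and d: "d \<in> B" for u c d x
  proof -
    define t where "t = (\<lambda>x. (u \<circ> (c \<circ> d)) x - (d \<circ> (u \<circ> c)) x)"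
    have "t \<in> D"
      unfolding t_def by (intro cstar_diff[OF cD] cstar_comp[OF cD] u subsetD[OF BD] c d)
    moreover have "b (t y) = 0" if b: "b \<in> B" for b y
    proof -
      have buc: "b \<circ> u \<circ> c \<in> B" using hered b u c DA by blast
      \<comment> \<open>\<open>b u c\<close> is in \<open>B\<close> and commutes with
        \<open>d\<close>; moving \<open>d\<close> past \<open>b\<close> as well makes the two terms
        of \<open>b t\<close> agree.\<close>
      have "b (u (c (d y))) = d (b (u (c y)))" using Bc[OF buc d] by simp
      then show ?thesis using b d B bA
        by (simp add: t_def bounded_op_diff subset_eq Bc[OF b d])
    qed
    ultimately have "t x = 0" by (rule left)
    then show ?thesis by (simp add: t_def)
  qed
  have central: "u (c x) = c (u x)" if u: "u \<in> D" and c: "c \<in> B" for u c x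
  proof -
    define t where "t = (\<lambda>x. (u \<circ> c) x - (c \<circ> u) x)"
    have "t \<in> D"
      unfolding t_def by (intro cstar_diff[OF cD] cstar_comp[OF cD] u subsetD[OF BD] c)
    \<comment> \<open>After rewriting \<open>c b\<close> as \<open>b c\<close>, this is the shift
      identity for the pair \<open>b\<close>, \<open>c\<close>.\<close>
    moreover have "t (b y) = 0" if b: "b \<in> B" for b y
      using shift[OF u b c, of y] by (simp add: t_def Bc[OF c b])
    ultimately have "t x = 0" by (rule right)
    then show ?thesis by (simp add: t_def)
  qed
  show "commutative_set (Ann A (Ann A B))"
    unfolding commutative_set_def N_def[symmetric] D_def[symmetric]
  proof (intro ballI ext)
    fix u v x assume u: "u \<in> D" and v: "v \<in> D"
    define t where "t = (\<lambda>x. (u \<circ> v) x - (v \<circ> u) x)"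
    have tD: "t \<in> D" unfolding t_def by (intro cstar_diff[OF cD] cstar_comp[OF cD] u v)
    \<comment> \<open>Centrality brings \<open>u v c d\<close> to \<open>c u d v\<close>. It also
      brings \<open>v u c d\<close> to \<open>v c u d\<close>, which equals \<open>c u d v\<close>
      because \<open>c u d\<close> is in \<open>B\<close> and so commutes with
      \<open>v\<close>.\<close>
    have tcd: "t (c (d y)) = 0" if c: "c \<in> B" and d: "d \<in> B" for c d y
    proof -
      have "c \<circ> u \<circ> d \<in> B" using hered c d u DA by blast
      from central[OF v this] have "v (c (u (d y))) = c (u (d (v y)))" by simp
      then show ?thesis
        by (simp add: t_def central[OF u c] central[OF v d] central[OF v c])
    qed
    \<comment> \<open>The right cancellation is used twice: first on \<open>t \<circ> c\<close> to
      remove \<open>d\<close>, then on \<open>t\<close> to remove \<open>c\<close>.\<close>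
    have "t (c y) = 0" if c: "c \<in> B" for c y
    proof -
      have "(t \<circ> c) y = 0"
        by (rule right[of "t \<circ> c"]) (use tcd[OF c] cstar_comp[OF cD tD] c BD in auto)
      then show ?thesis by simp
    qed
    with tD have "t x = 0" by (rule right)
    then show "(u \<circ> v) x = (v \<circ> u) x" by (simp add: t_def)
  qed
qed

end

theorem theorem18:
  fixes A :: "('h::complex_hilbert \<Rightarrow> 'h) set" and e :: "'h \<Rightarrow> 'h"
  assumes "cstar_algebra A"
    and "abelian_projection (weak_closure A) e"
    and "A \<inter> corner e (weak_closure A) \<noteq> {\<lambda>x. 0}"
  shows "cstar_algebra (Ann A (Ann A (A \<inter> corner e (weak_closure A))))
       \<and> commutative_set (Ann A (Ann A (A \<inter> corner e (weak_closure A))))"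
proof -
  let ?B = "A \<inter> corner e (weak_closure A)"
  note A = assms(1)
  have be: "bounded_op e" and ee: "e \<circ> e = e" and e_sa: "adjoint e = e"
    and comm: "commutative_set (corner e (weak_closure A))"
    using assms(2) by (auto simp: abelian_projection_def weak_closure_def)
  \<comment> \<open>Each operator in \<open>A\<close> approximates itself exactly.\<close>
  have AW: "a \<in> weak_closure A" if "a \<in> A" for a
    unfolding weak_closure_def using that cstar_bounded[OF A that]
    by (auto intro!: bexI[of _ a])
  \<comment> \<open>An element of \<open>A\<close> fixed by \<open>e\<close> on both sides is its
    own witness for lying in the corner. This form yields all closure properties of
    \<open>?B\<close> without any algebraic structure on the weak closure.\<close>
  have B_iff: "a \<in> ?B \<longleftrightarrow> a \<in> A \<and> e \<circ> a = a \<and> a \<circ> e = a" for a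
  proof
    assume "a \<in> ?B"
    then obtain m where "a \<in> A" "a = e \<circ> m \<circ> e" by (auto simp: corner_def)
    then show "a \<in> A \<and> e \<circ> a = a \<and> a \<circ> e = a"
      by (metis comp_assoc ee)
  next
    assume a: "a \<in> A \<and> e \<circ> a = a \<and> a \<circ> e = a"
    then have "a = e \<circ> a \<circ> e" by simp
    with a AW show "a \<in> ?B" unfolding corner_def by blast
  qed
  have sub: "?B \<subseteq> A" by blast
  have adj: "adjoint b \<in> ?B" if b: "b \<in> ?B" for b
  proof -
    have bb: "bounded_op b" and bA: "b \<in> A" using b cstar_bounded[OF A] by auto
    have "e \<circ> b = b" "b \<circ> e = b" using b by (auto simp only: B_iff)
    then have "adjoint b \<circ> e = adjoint b" "e \<circ> adjoint b = adjoint b"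
      using adjoint_comp[OF be bb] adjoint_comp[OF bb be] by (simp_all add: e_sa)
    then show ?thesis using cstar_adjoint[OF A bA] by (simp only: B_iff)
  qed
  have comp: "b \<circ> c \<in> ?B" if "b \<in> ?B" "c \<in> ?B" for b c
    using that cstar_comp[OF A] unfolding B_iff by (metis comp_assoc)
  have hered: "b \<circ> a \<circ> c \<in> ?B" if "b \<in> ?B" "a \<in> A" "c \<in> ?B" for b a c
    using that cstar_comp[OF A] unfolding B_iff by (metis comp_assoc)
  have "commutative_set ?B" using comm by (auto simp: commutative_set_def)
  then show ?thesis
    by (intro conjI commutative_Ann_Ann A sub adj comp hered)
qed

end
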